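(* Let $a,b,c\geq 1$ be integers and let $x$ be a nonzero complex number with $x^3\neq 1$. Let $n\geq 0$, $p\geq 0$ be integers such that $n\geq p$. Then $$\mathcal{BJ}_{n+p}^{(a,b,c)}(x)\,\mathcal{BJ}_{n-p}^{(a,b,c)}(x)-\left(\mathcal{BJ}_{n}^{(a,b,c)}(x)\right)^{2}=\frac{1}{(x^{2}+x+1)^{2}}\Big(-(x^{2}+x+1)\mathcal{A}_{p}^{2}\Phi_{1}\Phi_{2}+ x^{n+1}\Theta \left(\mathcal{B}_{n-p}(p)-x^{-p}\mathcal{B}_{n}(p)\right)\Big).$$
   Context: The third-order Jacobsthal polynomials are defined, for $x^3\neq 1$, by $\mathcal{J}_{0}^{(3)}(x)=0$, $\mathcal{J}_{1}^{(3)}(x)=1$, $\mathcal{J}_{2}^{(3)}(x)=x-1$ and $\mathcal{J}_{n+3}^{(3)}(x)=(x-1)\mathcal{J}_{n+2}^{(3)}(x)+(x-1)\mathcal{J}_{n+1}^{(3)}(x)+x\mathcal{J}_{n}^{(3)}(x)$ for $n\geq 0$. Bihyperbolic numbers are the elements $a_0+a_1j_1+a_2j_2+a_3j_3$ with multiplication determined by $j_1^2=j_2^2=j_3^2=1$, $j_1j_2=j_2j_1=j_3$, $j_1j_3=j_3j_1=j_2$, $j_2j_3=j_3j_2=j_1$; this gives a commutative associative unital algebra with basis $1,j_1,j_2,j_3$ (over $\mathbb{R}$ for bihyperbolic numbers proper). All identities are read in its complexification, i.e. coefficients $a_i$ are allowed to be complex. For integers $a,b,c\geq1$ and $n\geq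 0$, the generalized bihyperbolic third-order Jacobsthal polynomial is $\mathcal{BJ}_{n}^{(a,b,c)}(x)=\mathcal{J}_{n}^{(3)}(x)+\mathcal{J}_{n+a}^{(3)}(x)j_{1}+\mathcal{J}_{n+b}^{(3)}(x)j_{2}+\mathcal{J}_{n+c}^{(3)}(x)j_{3}$. Let $\omega_1,\omega_2$ be the two (complex) roots of $\lambda^2+\lambda+1=0$. Put $\Theta=1+x^{a}j_{1}+x^{b}j_{2}+x^{c}j_{3}$, $\Phi_{1}=1+\omega_{1}^{a}j_{1}+\omega_{1}^{b}j_{2}+\omega_{1}^{c}j_{3}$, $\Phi_{2}=1+\omega_{2}^{a}j_{1}+\omega_{2}^{b}j_{2}+\omega_{2}^{c}j_{3}$, $\mathcal{Z}_{n}(x)=\frac{1}{\omega_{1}-\omega_{2}}\left((\omega_{1}x-1)\omega_{1}^{n}\Phi_{1}-(\omega_{2}x-1)\omega_{2}^{n}\Phi_{2}\right)$, $\mathcal{A}_{n}=\frac{\omega_{1}^{n}-\omega_{2}^{n}}{\omega_{1}-\omega_{2}}$ and $\mathcal{B}_{n}(p)=\mathcal{Z}_{n+p}(x)-x^{p}\mathcal{Z}_{n}(x)$. *)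

theory Defs
  imports Complex_Main
begin

text \<open>
  \<open>Bihyp a0 a1 a2 a3\<close> stands for $a_0 + a_1 j_1 + a_2 j_2 + a_3 j_3$. With real coefficients these
  are the bihyperbolic numbers, with complex coefficients their complexification.
\<close>

datatype 'a bihyp = Bihyp (bh0: 'a) (bh1: 'a) (bh2: 'a) (bh3: 'a)

instantiation bihyp :: (comm_ring_1) comm_ring_1
begin

definition zero_bihyp :: "'a bihyp" where
  "0 = Bihyp 0 0 0 0"

definition one_bihyp :: "'a bihyp" where
  "1 = Bihyp 1 0 0 0"

definition plus_bihyp :: "'a bihyp \<Rightarrow> 'a bihyp \<Rightarrow> 'a bihyp" where
  "u + v = Bihyp (bh0 u + bh0 v) (bh1 u + bh1 v) (bh2 u + bh2 v) (bh3 u + bh3 v)"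

definition uminus_bihyp :: "'a bihyp \<Rightarrow> 'a bihyp" where
  "- u = Bihyp (- bh0 u) (- bh1 u) (- bh2 u) (- bh3 u)"

definition minus_bihyp :: "'a bihyp \<Rightarrow> 'a bihyp \<Rightarrow> 'a bihyp" where
  "u - v = Bihyp (bh0 u - bh0 v) (bh1 u - bh1 v) (bh2 u - bh2 v) (bh3 u - bh3 v)"

text \<open>The bilinear extension of the multiplication table proved in \<open>bihyp_unit_table\<close> below.\<close>

definition times_bihyp :: "'a bihyp \<Rightarrow> 'a bihyp \<Rightarrow> 'a bihyp" where
  "u * v = Bihyp
     (bh0 u * bh0 v + bh1 u * bh1 v + bh2 u * bh2 v + bh3 u * bh3 v)
     (bh0 u * bh1 v + bh1 u * bh0 v + bh2 u * bh3 v + bh3 u * bh2 v)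
     (bh0 u * bh2 v + bh2 u * bh0 v + bh1 u * bh3 v + bh3 u * bh1 v)
     (bh0 u * bh3 v + bh3 u * bh0 v + bh1 u * bh2 v + bh2 u * bh1 v)"

instance
  by standard
    (simp_all add: zero_bihyp_def one_bihyp_def plus_bihyp_def uminus_bihyp_def
      minus_bihyp_def times_bihyp_def algebra_simps bihyp.expand)

end

definition bh_scale :: "'a::comm_ring_1 \<Rightarrow> 'a bihyp \<Rightarrow> 'a bihyp"  (infixr "*\<^sub>b" 75) where
  "k *\<^sub>b u = Bihyp (k * bh0 u) (k * bh1 u) (k * bh2 u) (k * bh3 u)"

definition j1 :: "'a::comm_ring_1 bihyp" where "j1 = Bihyp 0 1 0 0"
definition j2 :: "'a::comm_ring_1 bihyp" where "j2 = Bihyp 0 0 1 0"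
definition j3 :: "'a::comm_ring_1 bihyp" where "j3 = Bihyp 0 0 0 1"

lemma Bihyp_basis_expansion:
  "Bihyp a0 a1 a2 a3 = a0 *\<^sub>b 1 + a1 *\<^sub>b j1 + a2 *\<^sub>b j2 + a3 *\<^sub>b j3"
  by (simp add: bh_scale_def j1_def j2_def j3_def one_bihyp_def plus_bihyp_def)

lemma bihyp_unit_table:
  "j1 * j1 = (1 :: 'a::comm_ring_1 bihyp)"
  "j2 * j2 = (1 :: 'a bihyp)"
  "j3 * j3 = (1 :: 'a bihyp)"
  "j1 * j2 = (j3 :: 'a bihyp)" "j2 * j1 = (j3 :: 'a bihyp)"
  "j1 * j3 = (j2 :: 'a bihyp)" "j3 * j1 = (j2 :: 'a bihyp)"
  "j2 * j3 = (j1 :: 'a bihyp)" "j3 * j2 = (j1 :: 'a bihyp)"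
  by (simp_all add: j1_def j2_def j3_def one_bihyp_def times_bihyp_def)

lemma bh_scale_mult:
  "(k *\<^sub>b u) * v = k *\<^sub>b (u * v)" "u * (k *\<^sub>b v) = k *\<^sub>b (u * v)"
  by (simp_all add: bh_scale_def times_bihyp_def algebra_simps)

fun jac3 :: "complex \<Rightarrow> nat \<Rightarrow> complex" where
  "jac3 x 0 = 0"
| "jac3 x (Suc 0) = 1"
| "jac3 x (Suc (Suc 0)) = x - 1"
| "jac3 x (Suc (Suc (Suc n))) =
     (x - 1) * jac3 x (Suc (Suc n)) + (x - 1) * jac3 x (Suc n) + x * jac3 x n"

definition bihyp_jac3 :: "nat \<Rightarrow> nat \<Rightarrow> nat \<Rightarrow> complex \<Rightarrow> nat \<Rightarrow> complex bihyp" where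
  "bihyp_jac3 a b c x n = Bihyp (jac3 x n) (jac3 x (n + a)) (jac3 x (n + b)) (jac3 x (n + c))"

text \<open>\<open>power_bihyp\<close> at $x$, $\omega_1$, $\omega_2$ gives $\Theta$, $\Phi_1$, $\Phi_2$ respectively.\<close>

definition power_bihyp :: "nat \<Rightarrow> nat \<Rightarrow> nat \<Rightarrow> complex \<Rightarrow> complex bihyp" where
  "power_bihyp a b c t = Bihyp 1 (t ^ a) (t ^ b) (t ^ c)"

text \<open>
  In the following, \<open>w1\<close> and \<open>w2\<close> stand for $\omega_1$ and $\omega_2$, the roots of
  $\lambda^2 + \lambda + 1$.
\<close>

definition Z_seq ::
  "complex \<Rightarrow> complex \<Rightarrow> nat \<Rightarrow> nat \<Rightarrow> nat \<Rightarrow> complex \<Rightarrow> nat \<Rightarrow> complex bihyp" where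
  "Z_seq w1 w2 a b c x n =
     (1 / (w1 - w2)) *\<^sub>b
       (((w1 * x - 1) * w1 ^ n) *\<^sub>b power_bihyp a b c w1
        - ((w2 * x - 1) * w2 ^ n) *\<^sub>b power_bihyp a b c w2)"

definition A_seq :: "complex \<Rightarrow> complex \<Rightarrow> nat \<Rightarrow> complex" where
  "A_seq w1 w2 n = (w1 ^ n - w2 ^ n) / (w1 - w2)"

definition B_seq ::
  "complex \<Rightarrow> complex \<Rightarrow> nat \<Rightarrow> nat \<Rightarrow> nat \<Rightarrow> complex \<Rightarrow> nat \<Rightarrow> nat \<Rightarrow> complex bihyp" where
  "B_seq w1 w2 a b c x n p =
     Z_seq w1 w2 a b c x (n + p) - x ^ p *\<^sub>b Z_seq w1 w2 a b c x n"

end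

theory Submission
  imports Defs
begin

text \<open>
  The characteristic polynomial of the recurrence factors as $(\lambda - x)(\lambda^2 + \lambda + 1)$,
  so $\mathcal{J}_n$ is a combination of $x^n$, $\omega_1^n$ and $\omega_2^n$. Multiplied by
  $q = x^2 + x + 1$, which does not vanish because $x^3 \neq 1$, this Binet formula becomes
  $q\,\mathcal{BJ}_n = x^{n+1}\Theta - \mathcal{Z}_n$ for the bihyperbolic sequence
  (lemma \<open>bihyp_jac3_binet\<close>).

  The left-hand side of the theorem is the Catalan defect $s_{n+p}s_{n-p} - s_n^2$ of the sequence
  $s = \mathcal{BJ}$. A geometric sequence has defect zero, so the defect of a difference of two
  sequences, one of them geometric, consists of the defect of the other one and of mixed terms
  (lemma \<open>catalan_defect_diff\<close>). This is used twice. For $\mathcal{Z}$, a difference of two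
  geometric sequences with ratios $\omega_1$ and $\omega_2$, only the mixed terms are left, and
  $\omega_1\omega_2 = 1$ makes them independent of $n$: they yield $-q\mathcal{A}_p^2\Phi_1\Phi_2$.
  For $x^{n+1}\Theta - \mathcal{Z}_n$ the defect of $\mathcal{Z}$ survives, and the mixed terms are
  the multiple of $\Theta$ that is expressed through $\mathcal{B}$.
\<close>

interpretation bihyp: module "bh_scale :: 'a::comm_ring_1 \<Rightarrow> 'a bihyp \<Rightarrow> 'a bihyp"
  by standard (simp_all add: bh_scale_def plus_bihyp_def algebra_simps)

lemma bh_scale_cancel:
  fixes k :: "'a::field"
  assumes "k \<noteq> 0" and "k *\<^sub>b u = v"
  shows "u = (1 / k) *\<^sub>b v"
  using assms by (auto simp: bihyp.scale_scale)

text \<open>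
  \<open>P\<close>, \<open>C\<close>, \<open>M\<close> are the terms of a geometric sequence at $n+p$, $n$, $n-p$, and \<open>z\<close>, \<open>w\<close>, \<open>y\<close>
  those of the subtracted sequence. Stating the geometric property as a product keeps the lemma
  free of division, since bihyperbolic numbers have zero divisors. The mixed terms are grouped
  the way $\mathcal{B}_{n-p}(p) - x^{-p}\mathcal{B}_n(p)$ pairs the terms of $\mathcal{Z}$.
\<close>

lemma catalan_defect_diff:
  fixes P M C z y w :: "'a::comm_ring_1"
  assumes "P * M = C\<^sup>2"
  shows "(P - z) * (M - y) - (C - w)\<^sup>2 = (z * y - w\<^sup>2) + (C * w - P * y) + (C * w - M * z)"
proof -
  have "(P - z) * (M - y) - (C - w)\<^sup>2
      = (P * M - C\<^sup>2) + (z * y - w\<^sup>2) + (C * w - P * y) + (C * w - M * z)"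
    by (simp add: power2_eq_square algebra_simps)
  then show ?thesis using assms by simp
qed

lemma omega_vieta:
  fixes w1 w2 :: complex
  assumes "w1\<^sup>2 + w1 + 1 = 0" and "w2\<^sup>2 + w2 + 1 = 0" and "w1 \<noteq> w2"
  shows "w1 + w2 = - 1" and "w1 * w2 = 1"
proof -
  have "(w1 - w2) * (w1 + w2 + 1) = (w1\<^sup>2 + w1 + 1) - (w2\<^sup>2 + w2 + 1)"
    by (simp add: power2_eq_square algebra_simps)
  then have "w1 + w2 + 1 = 0" using assms by simp
  then show sum: "w1 + w2 = - 1" by (simp add: eq_neg_iff_add_eq_0)
  then have w2: "w2 = - 1 - w1" by (simp add: algebra_simps eq_neg_iff_add_eq_0)
  have "w1 * w2 = 1 - (w1\<^sup>2 + w1 + 1)"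
    unfolding w2 by (simp add: power2_eq_square algebra_simps)
  then show "w1 * w2 = 1" using assms by simp
qed

text \<open>
  Each of $x$, $\omega_1$, $\omega_2$ is a root of the characteristic polynomial, so both sides
  satisfy the same third-order recurrence and it remains to compare three initial values.
\<close>

lemma jac3_binet:
  fixes x w1 w2 :: complex
  assumes w1: "w1\<^sup>2 + w1 + 1 = 0" and w2: "w2\<^sup>2 + w2 + 1 = 0" and ne: "w1 \<noteq> w2"
  shows "(x\<^sup>2 + x + 1) * jac3 x n
    = x ^ (n + 1) - 1 / (w1 - w2) * ((w1 * x - 1) * w1 ^ n - (w2 * x - 1) * w2 ^ n)"
proof -
  define r where "r n = x ^ (n + 1)
      - 1 / (w1 - w2) * ((w1 * x - 1) * w1 ^ n - (w2 * x - 1) * w2 ^ n)" for n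
  have char_root_rec: "w ^ (m + 3) = (x - 1) * w ^ (m + 2) + (x - 1) * w ^ (m + 1) + x * w ^ m"
    if "(w - x) * (w\<^sup>2 + w + 1) = 0" for w :: complex and m
  proof -
    have "w ^ (m + 3) - ((x - 1) * w ^ (m + 2) + (x - 1) * w ^ (m + 1) + x * w ^ m)
        = w ^ m * ((w - x) * (w\<^sup>2 + w + 1))"
      by (simp add: power_add power2_eq_square power3_eq_cube algebra_simps)
    then show ?thesis using that by simp
  qed
  have rec: "r (m + 3) = (x - 1) * r (m + 2) + (x - 1) * r (m + 1) + x * r m" for m
  proof -
    have px: "x ^ (m + 3 + 1)
        = (x - 1) * x ^ (m + 2 + 1) + (x - 1) * x ^ (m + 1 + 1) + x * x ^ (m + 1)"
      by (simp add: power_add power2_eq_square numeral_eq_Suc algebra_simps)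
    have p1: "w1 ^ (m + 3) = (x - 1) * w1 ^ (m + 2) + (x - 1) * w1 ^ (m + 1) + x * w1 ^ m"
      and p2: "w2 ^ (m + 3) = (x - 1) * w2 ^ (m + 2) + (x - 1) * w2 ^ (m + 1) + x * w2 ^ m"
      by (rule char_root_rec; simp add: w1 w2)+
    show ?thesis
      unfolding r_def px p1 p2 by algebra
  qed
  have init: "r 0 = 0" "r 1 = x\<^sup>2 + x + 1" "r 2 = (x\<^sup>2 + x + 1) * (x - 1)"
  proof -
    have sum: "w1 + w2 = - 1" and d: "w1 - w2 \<noteq> 0"
      using omega_vieta[OF assms] ne by auto
    have "(w1 * x - 1) * w1 ^ 0 - (w2 * x - 1) * w2 ^ 0 = (w1 - w2) * x"
      by (simp add: algebra_simps)
    then show "r 0 = 0" using d by (simp add: r_def)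
    have "(w1 * x - 1) * w1 ^ 1 - (w2 * x - 1) * w2 ^ 1 = (w1 - w2) * ((w1 + w2) * x - 1)"
      by (simp add: algebra_simps)
    also have "\<dots> = (w1 - w2) * (- x - 1)" by (simp add: sum)
    finally show "r 1 = x\<^sup>2 + x + 1" using d by (simp add: r_def power2_eq_square)
    have quad: "(w * x - 1) * w\<^sup>2 = x + w + 1" if "w\<^sup>2 + w + 1 = 0" for w :: complex
    proof -
      have "(w * x - 1) * w\<^sup>2 - (x + w + 1) = (w\<^sup>2 + w + 1) * ((w - 1) * x - 1)"
        by (simp add: power2_eq_square algebra_simps)
      then show ?thesis using that by simp
    qed
    have "(w1 * x - 1) * w1\<^sup>2 - (w2 * x - 1) * w2\<^sup>2 = w1 - w2"
      by (simp add: quad w1 w2)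
    then have "r 2 = x ^ 3 - 1" using d by (simp add: r_def)
    then show "r 2 = (x\<^sup>2 + x + 1) * (x - 1)"
      by (simp add: power2_eq_square power3_eq_cube algebra_simps)
  qed
  have "(x\<^sup>2 + x + 1) * jac3 x n = r n"
    using rec init
  proof (induction x n rule: jac3.induct)
    case (4 x m)
    have "(x\<^sup>2 + x + 1) * jac3 x (Suc (Suc (Suc m)))
        = (x - 1) * ((x\<^sup>2 + x + 1) * jac3 x (Suc (Suc m)))
          + (x - 1) * ((x\<^sup>2 + x + 1) * jac3 x (Suc m)) + x * ((x\<^sup>2 + x + 1) * jac3 x m)"
      by (simp add: algebra_simps)
    also have "\<dots> = (x - 1) * r (m + 2) + (x - 1) * r (m + 1) + x * r m"
      using 4 by simp
    also have "\<dots> = r (Suc (Suc (Suc m)))"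
      using "4.prems"(1)[of m] by (simp add: numeral_3_eq_3)
    finally show ?case .
  qed (simp_all add: numeral_2_eq_2)
  then show ?thesis by (simp add: r_def)
qed

lemma bihyp_jac3_binet:
  fixes x w1 w2 :: complex
  assumes "w1\<^sup>2 + w1 + 1 = 0" and "w2\<^sup>2 + w2 + 1 = 0" and "w1 \<noteq> w2"
  shows "(x\<^sup>2 + x + 1) *\<^sub>b bihyp_jac3 a b c x n
    = x ^ (n + 1) *\<^sub>b power_bihyp a b c x - Z_seq w1 w2 a b c x n"
  unfolding Z_seq_def bihyp_jac3_def power_bihyp_def
  by (simp add: bh_scale_def minus_bihyp_def jac3_binet[OF assms])
    (simp add: power_add mult_ac)

text \<open>
  Here $\mathcal{Z}_n = \omega_1^n R - \omega_2^n S$ with constant $R$ and $S$, whose product is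
  $q\,\Phi_1\Phi_2/(\omega_1-\omega_2)^2$ because
  $(\omega_1 x - 1)(\omega_2 x - 1) = x^2 + x + 1$.
\<close>

lemma Z_seq_catalan:
  fixes x w1 w2 :: complex
  assumes w: "w1\<^sup>2 + w1 + 1 = 0" "w2\<^sup>2 + w2 + 1 = 0" "w1 \<noteq> w2"
  shows "Z_seq w1 w2 a b c x (m + p + p) * Z_seq w1 w2 a b c x m - (Z_seq w1 w2 a b c x (m + p))\<^sup>2
    = (- (x\<^sup>2 + x + 1) * (A_seq w1 w2 p)\<^sup>2) *\<^sub>b (power_bihyp a b c w1 * power_bihyp a b c w2)"
proof -
  define d where "d = w1 - w2"
  define R where "R = ((w1 * x - 1) / d) *\<^sub>b power_bihyp a b c w1"
  define S where "S = ((w2 * x - 1) / d) *\<^sub>b power_bihyp a b c w2"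
  have Z: "Z_seq w1 w2 a b c x k = w1 ^ k *\<^sub>b R - w2 ^ k *\<^sub>b S" for k
    by (simp add: Z_seq_def R_def S_def d_def bihyp.scale_right_diff_distrib mult_ac)
  have geom: "(w ^ (m + p + p) *\<^sub>b T) * (w ^ m *\<^sub>b T) = (w ^ (m + p) *\<^sub>b T)\<^sup>2"
    for w :: complex and T
    by (simp add: bh_scale_mult power2_eq_square power_add mult_ac)
  have unit: "w1 ^ m * w2 ^ m = 1"
    using omega_vieta(2)[OF w] by (simp flip: power_mult_distrib)
  have "(w1 ^ (m + p) * w2 ^ (m + p) - w1 ^ (m + p + p) * w2 ^ m)
        + (w1 ^ (m + p) * w2 ^ (m + p) - w1 ^ m * w2 ^ (m + p + p))
      = - (w1 ^ m * w2 ^ m) * (w1 ^ p - w2 ^ p)\<^sup>2"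
    by (simp add: power_add power2_eq_square algebra_simps)
  then have mixed: "(w1 ^ (m + p) * w2 ^ (m + p) - w1 ^ (m + p + p) * w2 ^ m)
        + (w1 ^ (m + p) * w2 ^ (m + p) - w1 ^ m * w2 ^ (m + p + p))
      = - (w1 ^ p - w2 ^ p)\<^sup>2"
    by (simp add: unit)
  have "(w1 * x - 1) * (w2 * x - 1) = (w1 * w2) * x\<^sup>2 - (w1 + w2) * x + 1"
    by (simp add: power2_eq_square algebra_simps)
  also have "\<dots> = x\<^sup>2 + x + 1"
    by (simp add: omega_vieta[OF w])
  finally have RS: "R * S = ((x\<^sup>2 + x + 1) / d\<^sup>2) *\<^sub>b (power_bihyp a b c w1 * power_bihyp a b c w2)"
    by (simp add: R_def S_def bh_scale_mult power2_eq_square mult_ac)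
  have "Z_seq w1 w2 a b c x (m + p + p) * Z_seq w1 w2 a b c x m - (Z_seq w1 w2 a b c x (m + p))\<^sup>2
      = ((w1 ^ (m + p) *\<^sub>b R) * (w2 ^ (m + p) *\<^sub>b S) - (w1 ^ (m + p + p) *\<^sub>b R) * (w2 ^ m *\<^sub>b S))
        + ((w1 ^ (m + p) *\<^sub>b R) * (w2 ^ (m + p) *\<^sub>b S) - (w1 ^ m *\<^sub>b R) * (w2 ^ (m + p + p) *\<^sub>b S))"
    unfolding Z catalan_defect_diff[OF geom] by (simp add: geom)
  also have "\<dots> = ((w1 ^ (m + p) * w2 ^ (m + p) - w1 ^ (m + p + p) * w2 ^ m)
        + (w1 ^ (m + p) * w2 ^ (m + p) - w1 ^ m * w2 ^ (m + p + p))) *\<^sub>b (R * S)"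
    by (simp only: bh_scale_mult bihyp.scale_scale bihyp.scale_left_diff_distrib
        bihyp.scale_left_distrib mult_ac)
  also have "\<dots> = (- (x\<^sup>2 + x + 1) * (A_seq w1 w2 p)\<^sup>2)
      *\<^sub>b (power_bihyp a b c w1 * power_bihyp a b c w2)"
    unfolding mixed RS A_seq_def d_def by (simp add: power_divide mult_ac del: minus_add_distrib)
  finally show ?thesis .
qed

theorem corollary2p7:
  fixes a b c n p :: nat and x w1 w2 :: complex
  assumes "a \<ge> 1" and "b \<ge> 1" and "c \<ge> 1"
    and "x \<noteq> 0" and "x ^ 3 \<noteq> 1"
    and "w1\<^sup>2 + w1 + 1 = 0" and "w2\<^sup>2 + w2 + 1 = 0" and "w1 \<noteq> w2"
    and "n \<ge> p"
  shows "bihyp_jac3 a b c x (n + p) * bihyp_jac3 a b c x (n - p) - (bihyp_jac3 a b c x n)\<^sup>2 =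
    (1 / (x\<^sup>2 + x + 1)\<^sup>2) *\<^sub>b
      ((- (x\<^sup>2 + x + 1) * (A_seq w1 w2 p)\<^sup>2) *\<^sub>b (power_bihyp a b c w1 * power_bihyp a b c w2)
       + (x ^ (n + 1)) *\<^sub>b
           (power_bihyp a b c x *
             (B_seq w1 w2 a b c x (n - p) p - (x powi (- int p)) *\<^sub>b B_seq w1 w2 a b c x n p)))"
proof -
  define q where "q = x\<^sup>2 + x + 1"
  define \<Theta> where "\<Theta> = power_bihyp a b c x"
  define J where "J = bihyp_jac3 a b c x"
  define Z where "Z = Z_seq w1 w2 a b c x"
  obtain m where n: "n = m + p"
    using \<open>n \<ge> p\<close> by (metis le_add_diff_inverse2)
  have "(x - 1) * q = x ^ 3 - 1"
    by (simp add: q_def power2_eq_square power3_eq_cube algebra_simps)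
  then have q: "q\<^sup>2 \<noteq> 0"
    using \<open>x ^ 3 \<noteq> 1\<close> by auto
  have binet: "q *\<^sub>b J k = x ^ (k + 1) *\<^sub>b \<Theta> - Z k" for k
    unfolding q_def \<Theta>_def J_def Z_def by (intro bihyp_jac3_binet assms)
  have geom: "(x ^ (m + p + p + 1) *\<^sub>b \<Theta>) * (x ^ (m + 1) *\<^sub>b \<Theta>) = (x ^ (m + p + 1) *\<^sub>b \<Theta>)\<^sup>2"
    by (simp add: bh_scale_mult power2_eq_square power_add mult_ac)
  have B: "B_seq w1 w2 a b c x m p - (x powi (- int p)) *\<^sub>b B_seq w1 w2 a b c x n p
      = (Z n - x ^ p *\<^sub>b Z m) + (Z n - inverse (x ^ p) *\<^sub>b Z (m + p + p))"
    using \<open>x \<noteq> 0\<close>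
    by (simp add: B_seq_def n Z_def power_int_minus bihyp.scale_right_diff_distrib)
  have mixed: "((x ^ (m + p + 1) *\<^sub>b \<Theta>) * Z (m + p) - (x ^ (m + p + p + 1) *\<^sub>b \<Theta>) * Z m)
        + ((x ^ (m + p + 1) *\<^sub>b \<Theta>) * Z (m + p) - (x ^ (m + 1) *\<^sub>b \<Theta>) * Z (m + p + p))
      = x ^ (n + 1) *\<^sub>b (\<Theta> * ((Z n - x ^ p *\<^sub>b Z m) + (Z n - inverse (x ^ p) *\<^sub>b Z (m + p + p))))"
    using \<open>x \<noteq> 0\<close>
    by (simp add: n bh_scale_mult bihyp.scale_right_diff_distrib bihyp.scale_right_distrib
        distrib_left distrib_right right_diff_distrib power_add mult_ac)
  have "q\<^sup>2 *\<^sub>b (J (m + p + p) * J m - (J (m + p))\<^sup>2)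
      = (q *\<^sub>b J (m + p + p)) * (q *\<^sub>b J m) - (q *\<^sub>b J (m + p))\<^sup>2"
    by (simp add: bh_scale_mult power2_eq_square bihyp.scale_right_diff_distrib)
  also have "\<dots> = (Z (m + p + p) * Z m - (Z (m + p))\<^sup>2)
      + (((x ^ (m + p + 1) *\<^sub>b \<Theta>) * Z (m + p) - (x ^ (m + p + p + 1) *\<^sub>b \<Theta>) * Z m)
        + ((x ^ (m + p + 1) *\<^sub>b \<Theta>) * Z (m + p) - (x ^ (m + 1) *\<^sub>b \<Theta>) * Z (m + p + p)))"
    unfolding binet catalan_defect_diff[OF geom] by (rule add.assoc)
  also have "Z (m + p + p) * Z m - (Z (m + p))\<^sup>2 = (- (x\<^sup>2 + x + 1) * (A_seq w1 w2 p)\<^sup>2)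
      *\<^sub>b (power_bihyp a b c w1 * power_bihyp a b c w2)"
    unfolding Z_def by (intro Z_seq_catalan assms)
  finally have "q\<^sup>2 *\<^sub>b (J (m + p + p) * J m - (J (m + p))\<^sup>2)
      = (- (x\<^sup>2 + x + 1) * (A_seq w1 w2 p)\<^sup>2) *\<^sub>b (power_bihyp a b c w1 * power_bihyp a b c w2)
        + x ^ (n + 1) *\<^sub>b (\<Theta> * (B_seq w1 w2 a b c x m p
            - (x powi (- int p)) *\<^sub>b B_seq w1 w2 a b c x n p))"
    unfolding mixed B .
  then have "J (m + p + p) * J m - (J (m + p))\<^sup>2
      = (1 / q\<^sup>2) *\<^sub>b ((- (x\<^sup>2 + x + 1) * (A_seq w1 w2 p)\<^sup>2)
          *\<^sub>b (power_bihyp a b c w1 * power_bihyp a b c w2)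
        + x ^ (n + 1) *\<^sub>b (\<Theta> * (B_seq w1 w2 a b c x m p
            - (x powi (- int p)) *\<^sub>b B_seq w1 w2 a b c x n p)))"
    by (rule bh_scale_cancel[OF q])
  moreover have "n + p = m + p + p" "n - p = m"
    by (simp_all add: n)
  ultimately show ?thesis
    by (simp only: J_def \<Theta>_def q_def n)
qed

end
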